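(* Let $n\ge2$, $k>0$, and $p,q\in\mathbb{Z}_{\ge0}$ with $p\ge q$. Let $(p,q,\dots,q)$ denote the partition of length at most $n$ with first part $p$ and the remaining $n-1$ parts equal to $q$. Then, as an identity of functions of $z\in\mathbb{C}^n$ (with $z_n\neq0$ on the right-hand side), \begin{align*} P^{(1/k)}_{(p,q,\dots,q)}(z_1,\dots,z_n)&=\frac{(nk)_{p-q}}{(k)_{p-q}}\prod_{i=1}^{n-1}z_i^{q}\,z_n^{p}\,F_D\Bigl(q-p,k,\dots,k,nk;\,1-\frac{z_1}{z_n},\dots,1-\frac{z_{n-1}}{z_n}\Bigr)\\ &=\prod_{i=1}^{n-1}z_i^{q}\,z_n^{p}\,F_D\Bigl(q-p,k,\dots,k,q-p-k+1;\,\frac{z_1}{z_n},\dots,\frac{z_{n-1}}{z_n}\Bigr), \end{align*} where both $F_D$ series terminate since $q-p\in\mathbb{Z}_{\le0}$.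
   Context: A partition of length at most $n$ is $\lambda=(\lambda_1,\dots,\lambda_n)\in\mathbb{Z}_{\ge0}^n$ with $\lambda_1\ge\cdots\ge\lambda_n$; $|\lambda|=\sum\lambda_i$. Dominance order: $\mu\le\lambda$ iff $|\mu|=|\lambda|$ and $\sum_{i\le j}\mu_i\le\sum_{i\le j}\lambda_i$ for all $j$. Monomial symmetric function $m_\lambda=\sum_{\alpha\in S_n\lambda}z^\alpha$. With $\vartheta_i=z_i\partial/\partial z_i$ and $L(k)=\sum_i\vartheta_i^2+k\sum_{1\le i<j\le n}\frac{z_i+z_j}{z_i-z_j}(\vartheta_i-\vartheta_j)$, the Jack polynomial $P^{(1/k)}_\lambda$ is the unique polynomial of the form $\sum_{\mu\le\lambda}v_{\lambda\mu}m_\mu$ with $v_{\lambda\lambda}=1$ satisfying $L(k)P^{(1/k)}_\lambda=h(\lambda)P^{(1/k)}_\lambda$, where $h(\lambda)=\sum_{i=1}^n\lambda_i(\lambda_i+k(n+1-2i))$. Lauricella's $F_D$ in $m=n-1$ variables: $F_D(\alpha,\beta_1,\dots,\beta_m,\gamma;x)=\sum_{m_1,\dots,m_m\ge0}\frac{(\alpha)_{|m|}(\beta_1)_{m_1}\cdots(\beta_m)_{m_m}}{(\gamma)_{|m|}m_1!\cdots m_m!}x_1^{m_1}\cdots x_m^{m_m}$, $|m|=\sum m_i$, $(a)_0=1$, $(a)_j=a(a+1)\cdots(a+j-1)$. *)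

theory Defs
  imports "HOL-Analysis.Analysis" "HOL-Library.Multiset"
begin

text \<open>Points of C^n are functions nat => complex; only coordinates 0..n-1 are used
  (coordinate i here is z_(i+1) of the paper). Partitions of length at most n are
  lists of naturals of length n, weakly decreasing.\<close>

definition is_partition :: "nat \<Rightarrow> nat list \<Rightarrow> bool" where
  "is_partition n lam \<longleftrightarrow> length lam = n \<and> sorted_wrt (\<ge>) lam"

definition dominates :: "nat list \<Rightarrow> nat list \<Rightarrow> bool" where
  "dominates mu lam \<longleftrightarrow> sum_list mu = sum_list lam \<and>
     (\<forall>j. sum_list (take j mu) \<le> sum_list (take j lam))"

definition monomial_sym :: "nat list \<Rightarrow> (nat \<Rightarrow> complex) \<Rightarrow> complex" where
  "monomial_sym lam z = (\<Sum>\<alpha>\<in>{\<alpha>. mset \<alpha> = mset lam}. \<Prod>i<length lam. z i ^ (\<alpha> ! i))"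

definition theta :: "nat \<Rightarrow> ((nat \<Rightarrow> complex) \<Rightarrow> complex) \<Rightarrow> (nat \<Rightarrow> complex) \<Rightarrow> complex" where
  "theta i f z = z i * deriv (\<lambda>t. f (z(i := t))) (z i)"

definition L_op :: "nat \<Rightarrow> real \<Rightarrow> ((nat \<Rightarrow> complex) \<Rightarrow> complex) \<Rightarrow> (nat \<Rightarrow> complex) \<Rightarrow> complex" where
  "L_op n k f z = (\<Sum>i<n. theta i (theta i f) z)
     + of_real k * (\<Sum>i<n. \<Sum>j\<in>{i<..<n}. (z i + z j) / (z i - z j) * (theta i f z - theta j f z))"

text \<open>Eigenvalue h(lambda) (0-based index i corresponds to paper index i+1).\<close>
definition h_eig :: "nat \<Rightarrow> real \<Rightarrow> nat list \<Rightarrow> real" where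
  "h_eig n k lam = (\<Sum>i<n. real (lam ! i) * (real (lam ! i) + k * (real n - 1 - 2 * real i)))"

text \<open>Jack polynomial P^(1/k)_lam: the unique function of the form sum_{mu <= lam} v_mu m_mu
  with v_lam = 1 and L(k) P = h(lam) P (as an identity on points with pairwise distinct
  coordinates, where L(k) is defined).\<close>
definition jack :: "nat \<Rightarrow> real \<Rightarrow> nat list \<Rightarrow> (nat \<Rightarrow> complex) \<Rightarrow> complex" where
  "jack n k lam = (THE f. \<exists>v :: nat list \<Rightarrow> complex. v lam = 1 \<and>
      f = (\<lambda>z. \<Sum>mu\<in>{mu. is_partition n mu \<and> dominates mu lam}. v mu * monomial_sym mu z) \<and>
      (\<forall>z. (\<forall>i<n. \<forall>j<n. i \<noteq> j \<longrightarrow> z i \<noteq> z j) \<longrightarrow>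
           L_op n k f z = of_real (h_eig n k lam) * f z))"

definition lauricella_FD :: "complex \<Rightarrow> (nat \<Rightarrow> complex) \<Rightarrow> complex \<Rightarrow> nat \<Rightarrow> (nat \<Rightarrow> complex) \<Rightarrow> complex" where
  "lauricella_FD a b c m x = (\<Sum>\<^sub>\<infinity>ms\<in>{ms :: nat list. length ms = m}.
      pochhammer a (sum_list ms) * (\<Prod>i<m. pochhammer (b i) (ms ! i))
      / (pochhammer c (sum_list ms) * (\<Prod>i<m. fact (ms ! i)))
      * (\<Prod>i<m. x i ^ (ms ! i)))"

end

theory Submission imports Defs
begin

text \<open>
  Up to a scalar, the Jack polynomial of \<open>(p,q,\<dots>,q)\<close> is \<open>\<Prod>z\<^sub>i^q\<close> times the coefficient of
  \<open>t^(p-q)\<close> in \<open>\<Prod>(1 - z\<^sub>i t)^(-k)\<close>. That this is an eigenfunction reduces to an identity for each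
  pair of variables, because \<open>(1 - zt)^(-k)\<close> satisfies a first order differential equation.
  For uniqueness, look at a difference of two candidates in the region
  \<open>|z\<^sub>1| >> \<dots> >> |z\<^sub>n|\<close>: there \<open>L(k)\<close> acts diagonally on its dominant monomial, and \<open>(p,q,\<dots>,q)\<close>
  is the only exponent vector with all entries at least \<open>q\<close>, the same sum, and the same eigenvalue.
  After scaling to \<open>z\<^sub>n = 1\<close>, the second formula is the expansion of
  \<open>(1-t)^(-k) \<cdot> \<Prod>(1 - x\<^sub>i t)^(-k)\<close>, and the first follows by substituting \<open>t \<mapsto> -t/(1-t)\<close>
  in the same product with \<open>1 - x\<^sub>i\<close> in place of \<open>x\<^sub>i\<close>.
\<close>

section \<open>Negative binomial series and Lauricella's function\<close>

text \<open>\<open>negbin a x\<close> is the series of \<open>(1 - xt)^(-a)\<close>.\<close>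

definition negbin :: "'a::field_char_0 \<Rightarrow> 'a \<Rightarrow> 'a fps" where
  "negbin a x = Abs_fps (\<lambda>m. pochhammer a m / fact m * x ^ m)"

lemma negbin_nth: "fps_nth (negbin a x) m = pochhammer a m / fact m * x ^ m"
  by (simp add: negbin_def)

lemma fps_nth_deriv_mult_linear:
  "fps_nth ((1 - fps_const x * fps_X) * fps_deriv f) m =
     of_nat (Suc m) * fps_nth f (Suc m) - x * of_nat m * fps_nth f m"
  for x :: "'a::field_char_0"
  by (cases m) (simp_all add: left_diff_distrib mult.assoc)

lemma negbin_nth_Suc:
  "of_nat (Suc m) * fps_nth (negbin a x) (Suc m) = x * (a + of_nat m) * fps_nth (negbin a x) m"
proof -
  have "fps_nth (negbin a x) (Suc m) = x * (a + of_nat m) * fps_nth (negbin a x) m / of_nat (Suc m)"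
    by (simp add: negbin_nth pochhammer_Suc mult_ac)
  then show ?thesis
    by (metis nonzero_mult_div_cancel_left of_nat_neq_0 times_divide_eq_right)
qed

lemma negbin_deriv:
  "(1 - fps_const x * fps_X) * fps_deriv (negbin a x) = fps_const (a * x) * negbin a x"
  by (rule fps_ext)
    (simp only: fps_nth_deriv_mult_linear negbin_nth_Suc fps_mult_left_const_nth, simp add: algebra_simps)

text \<open>Comparing coefficients turns the differential equation into a two-term recursion, which
  fixes the whole series from its constant term. This identifies a series as a \<open>negbin\<close>
  without expanding it.\<close>

lemma negbin_unique:
  assumes "(1 - fps_const x * fps_X) * fps_deriv f = fps_const (a * x) * f"
  shows "f = fps_const (fps_nth f 0) * negbin a x"
proof (rule fps_ext)
  fix m
  show "fps_nth f m = fps_nth (fps_const (fps_nth f 0) * negbin a x) m"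
  proof (induction m)
    case 0
    then show ?case by (simp add: negbin_nth)
  next
    case (Suc m)
    have "fps_nth ((1 - fps_const x * fps_X) * fps_deriv f) m = a * x * fps_nth f m"
      by (simp add: assms)
    then have "of_nat (Suc m) * fps_nth f (Suc m) = x * (a + of_nat m) * fps_nth f m"
      unfolding fps_nth_deriv_mult_linear by (simp add: algebra_simps)
    also have "\<dots> = of_nat (Suc m) * fps_nth (fps_const (fps_nth f 0) * negbin a x) (Suc m)"
      unfolding Suc using negbin_nth_Suc[of m a x] by (simp add: mult_ac)
    finally show ?case by (metis mult_cancel_left of_nat_neq_0)
  qed
qed

text \<open>The coefficientwise content is the Vandermonde convolution
  \<open>pochhammer_binomial_sum\<close>.\<close>

lemma negbin_mult: "negbin a x * negbin b x = negbin (a + b) x"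
proof (rule fps_ext)
  fix m
  have "fps_nth (negbin a x * negbin b x) m = (\<Sum>i=0..m. pochhammer a i / fact i * x ^ i * (pochhammer b (m - i) / fact (m - i) * x ^ (m - i)))"
    by (simp add: fps_mult_nth negbin_nth)
  also have "\<dots> = (\<Sum>i\<le>m. of_nat (m choose i) * pochhammer a i * pochhammer b (m - i)) / fact m * x ^ m"
    unfolding sum_divide_distrib sum_distrib_right atLeast0AtMost
  proof (rule sum.cong[OF refl])
    fix i assume "i \<in> {..m}"
    then have "x ^ m = x ^ i * x ^ (m - i)" and "of_nat (m choose i) = (fact m / (fact i * fact (m - i)) :: 'a)"
      by (simp_all add: binomial_fact flip: power_add)
    then show "pochhammer a i / fact i * x ^ i * (pochhammer b (m - i) / fact (m - i) * x ^ (m - i))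
       = of_nat (m choose i) * pochhammer a i * pochhammer b (m - i) / fact m * x ^ m" by simp
  qed
  finally show "fps_nth (negbin a x * negbin b x) m = fps_nth (negbin (a + b) x) m"
    by (simp add: negbin_nth pochhammer_binomial_sum)
qed

lemma negbin_zero: "negbin 0 x = 1"
  by (rule fps_ext) (auto simp: negbin_nth pochhammer_0_left)

lemma negbin_power: "negbin a x ^ m = negbin (of_nat m * a) x"
  by (induction m) (auto simp: negbin_zero negbin_mult algebra_simps)

lemma negbin_one_one: "(1 - fps_X) * negbin 1 1 = (1 :: 'a::field_char_0 fps)"
proof (rule fps_ext)
  fix m show "fps_nth ((1 - fps_X) * negbin 1 1) m = fps_nth (1 :: 'a fps) m"
  proof -
    have "fps_nth (negbin 1 1 :: 'a fps) m = 1" for m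
      unfolding negbin_nth by (simp flip: pochhammer_fact)
    then show ?thesis by (cases m) (simp_all add: left_diff_distrib)
  qed
qed

text \<open>The substitution \<open>t \<mapsto> -t/(1-t)\<close> turns \<open>1 - yt\<close> into \<open>(1-(1-y)t)/(1-t)\<close>.\<close>

lemma negbin_compose:
  fixes a y :: "'a::field_char_0"
  shows "negbin a 1 * (negbin a y oo - (fps_X * negbin 1 1)) = negbin a (1 - y)"
proof -
  define s w P A :: "'a fps" where "s = - (fps_X * negbin 1 1)" and "w = 1 - fps_X"
    and "P = negbin a 1" and "A = negbin a y oo s"
  define D v where "D = P * A" and "v = 1 - fps_const (1 - y) * fps_X"
  have s0: "fps_nth s 0 = 0" by (simp add: s_def)
  have "w * s = - (fps_X * ((1 - fps_X) * negbin 1 1))" by (simp add: s_def w_def mult_ac)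
  then have ws: "w * s = - fps_X" unfolding negbin_one_one by simp
  from ws have "fps_deriv (w * s) = - 1" by simp
  then have "w * fps_deriv s = s - 1" by (simp add: w_def algebra_simps)
  then have "w * (w * fps_deriv s) = w * (s - 1)" by simp
  also have "\<dots> = - 1" using ws by (simp add: algebra_simps) (simp add: w_def)
  finally have s': "w * (w * fps_deriv s) = - 1" .
  have P': "w * fps_deriv P = fps_const a * P"
    using negbin_deriv[of 1 a] by (simp add: w_def P_def)
  define b where "b = fps_deriv (negbin a y) oo s"
  have A': "fps_deriv A = b * fps_deriv s" 
    using s0 by (simp add: A_def b_def fps_compose_deriv)
  have "((1 - fps_const y * fps_X) * fps_deriv (negbin a y)) oo s = (fps_const (a * y) * negbin a y) oo s"
    by (simp add: negbin_deriv)
  then have b: "(1 - fps_const y * s) * b = fps_const (a * y) * A"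
    using s0 by (simp add: fps_compose_mult_distrib fps_compose_sub_distrib b_def A_def)
  have v: "v = w * (1 - fps_const y * s)"
  proof -
    have "w * (1 - fps_const y * s) = w - fps_const y * (w * s)" by (simp add: algebra_simps)
    also have "\<dots> = v" unfolding ws by (simp add: v_def w_def algebra_simps flip: fps_const_sub)
    finally show ?thesis by simp
  qed
  have vy: "v - fps_const y = fps_const (1 - y) * w"
    by (simp add: v_def w_def algebra_simps flip: fps_const_sub)
  \<comment> \<open>The differential equation for \<open>D\<close> is checked after multiplication
    by \<open>w\<close>: the derivative of \<open>P\<close> has denominator \<open>1 - t\<close> and
    that of \<open>s\<close> has \<open>(1 - t)^2\<close>, where the second factor \<open>w\<close>
    is supplied by \<open>v\<close>.\<close>
  have "w * (v * fps_deriv D) = v * (w * fps_deriv P) * A + P * w * v * (b * fps_deriv s)"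
    by (simp add: D_def A' algebra_simps)
  also have "P * w * v * (b * fps_deriv s) = P * ((1 - fps_const y * s) * b) * (w * (w * fps_deriv s))"
    by (simp add: v mult_ac)
  also have "v * (w * fps_deriv P) * A + \<dots> = fps_const a * P * A * (v - fps_const y)"
    unfolding P' b s' fps_const_mult[symmetric] by (simp only: algebra_simps mult_minus_left mult_minus_right mult_1_left mult_1_right, simp)
  also have "\<dots> = w * (fps_const (a * (1 - y)) * D)"
    unfolding vy by (simp add: D_def mult_ac flip: fps_const_mult)
  finally have "w * (v * fps_deriv D) = w * (fps_const (a * (1 - y)) * D)" .
  moreover have "w \<noteq> 0"
  proof
    assume "w = 0" then have "fps_nth w 0 = 0" by simp then show False by (simp add: w_def)
  qed
  ultimately have "v * fps_deriv D = fps_const (a * (1 - y)) * D" by simp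
  from negbin_unique[OF this[unfolded v_def]]
  have "D = negbin a (1 - y)"
    using s0 by (simp add: D_def P_def A_def negbin_nth)
  then show ?thesis by (simp add: D_def P_def A_def s_def)
qed

text \<open>Since \<open>s\<close> has no constant term, \<open>s ^ r\<close> starts at degree at
  least \<open>r\<close>. One range \<open>r \<le> d\<close> therefore serves all coefficients up to
  index \<open>d\<close>, and the two sums can be exchanged.\<close>

lemma fps_nth_mult_compose:
  fixes c H s :: "'a::field_char_0 fps"
  assumes "fps_nth s 0 = 0"
  shows "fps_nth (c * (H oo s)) d = (\<Sum>r=0..d. fps_nth H r * fps_nth (c * s ^ r) d)"
proof -
  have *: "fps_nth (H oo s) j = (\<Sum>r=0..d. fps_nth H r * fps_nth (s ^ r) j)" if "j \<le> d" for j
    unfolding fps_compose_nth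
    by (rule sum.mono_neutral_left) (use that assms in \<open>auto simp: startsby_zero_power_prefix\<close>)
  have "fps_nth (c * (H oo s)) d = (\<Sum>i=0..d. fps_nth c i * (\<Sum>r=0..d. fps_nth H r * fps_nth (s ^ r) (d - i)))"
    by (simp add: fps_mult_nth *)
  also have "\<dots> = (\<Sum>r=0..d. fps_nth H r * fps_nth (c * s ^ r) d)"
    unfolding fps_mult_nth sum_distrib_left
    by (subst sum.swap) (simp add: mult_ac)
  finally show ?thesis .
qed

text \<open>Rewriting each factor by \<open>negbin_compose\<close> leaves \<open>(1-t)^(-a)\<close>
  once for each index and once more for the factor in front, hence \<open>Suc (card I)\<close>. The
  power \<open>s ^ r\<close> contributes \<open>(-1)^r t^r (1-t)^(-r)\<close>, which shifts the
  Pochhammer argument by \<open>r\<close>.\<close>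

lemma negbin_prod_one_minus_nth:
  fixes a :: "'a::field_char_0"
  assumes "finite I"
  shows "fps_nth (negbin a 1 * (\<Prod>i\<in>I. negbin a (1 - y i))) d =
    (\<Sum>r=0..d. (-1) ^ r * pochhammer (of_nat (Suc (card I)) * a + of_nat r) (d - r) / fact (d - r)
        * fps_nth (\<Prod>i\<in>I. negbin a (y i)) r)"
proof -
  define s :: "'a fps" where "s = - (fps_X * negbin 1 1)"
  define c where "c = negbin (of_nat (Suc (card I)) * a) 1"
  have s0: "fps_nth s 0 = 0" by (simp add: s_def)
  have "negbin a 1 * (\<Prod>i\<in>I. negbin a (1 - y i)) = negbin a 1 ^ Suc (card I) * (\<Prod>i\<in>I. negbin a (y i) oo s)"
    by (simp add: negbin_compose[symmetric] prod.distrib s_def mult_ac)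
  also have "\<dots> = c * ((\<Prod>i\<in>I. negbin a (y i)) oo s)"
    unfolding negbin_power c_def by (simp add: fps_compose_prod_distrib s0)
  finally have "fps_nth (negbin a 1 * (\<Prod>i\<in>I. negbin a (1 - y i))) d =
      (\<Sum>r=0..d. fps_nth (\<Prod>i\<in>I. negbin a (y i)) r * fps_nth (c * s ^ r) d)"
    by (simp add: fps_nth_mult_compose s0)
  moreover have "fps_nth (c * s ^ r) d = (-1) ^ r * pochhammer (of_nat (Suc (card I)) * a + of_nat r) (d - r) / fact (d - r)"
    if "r \<le> d" for r
  proof -
    have "s ^ r = fps_const ((-1) ^ r) * (fps_X ^ r * negbin (of_nat r) 1)"
      unfolding s_def power_minus[of "_ * _"] power_mult_distrib negbin_power
      by (simp flip: fps_const_power fps_const_neg)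
    then have "c * s ^ r = fps_const ((-1) ^ r) * (fps_X ^ r * (c * negbin (of_nat r) 1))"
      by (simp add: mult_ac)
    then show ?thesis using that
      by (simp add: c_def negbin_mult negbin_nth fps_X_power_mult_nth)
  qed
  ultimately show ?thesis by (simp add: mult_ac)
qed

section \<open>Terminating Lauricella series\<close>

lemma pochhammer_minus_of_nat:
  assumes "r \<le> d"
  shows "pochhammer (- of_nat d) r = ((-1) ^ r * fact d / fact (d - r) :: 'a::field_char_0)"
proof -
  have "fact d = (fact (d - r) * pochhammer (of_nat (d - r) + 1) r :: 'a)"
    using pochhammer_product[of "d - r" d "1::'a"] assms by (simp add: pochhammer_fact add.commute)
  then show ?thesis using assms by (simp add: pochhammer_minus of_nat_diff)
qed

lemma fps_prod_nth_lessThan: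
  fixes a :: "nat \<Rightarrow> 'a::comm_ring_1 fps"
  assumes "m > 0"
  shows "fps_nth (\<Prod>i<m. a i) d = (\<Sum>v\<in>natpermute d m. \<Prod>i<m. fps_nth (a i) (v ! i))"
proof -
  obtain l where "m = Suc l" using assms by (cases m) auto
  then show ?thesis using fps_prod_nth[of a l d]
    by (simp add: atLeast0AtMost lessThan_Suc_atMost)
qed

text \<open>Scaling all variables by \<open>c\<close> is the substitution of \<open>ct\<close> for
  \<open>t\<close>, so the coefficient of \<open>t^r\<close> is homogeneous of degree
  \<open>r\<close>.\<close>

lemma negbin_prod_scale:
  "fps_nth (\<Prod>i\<in>I. negbin a (c * x i)) r = c ^ r * fps_nth (\<Prod>i\<in>I. negbin a (x i)) r"
proof -
  have "negbin a (c * y) = negbin a y oo (fps_const c * fps_X)" for y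
    by (rule fps_ext) (simp add: negbin_nth power_mult_distrib fps_compose_linear)
  then have "(\<Prod>i\<in>I. negbin a (c * x i)) = (\<Prod>i\<in>I. negbin a (x i)) oo (fps_const c * fps_X)"
    by (simp add: fps_compose_prod_distrib)
  then show ?thesis by (simp add: fps_compose_linear)
qed

text \<open>The factor \<open>pochhammer (- of_nat d)\<close> kills all index lists of total above
  \<open>d\<close>. The remaining ones, grouped by their total \<open>r\<close>, are exactly those
  in the coefficient of \<open>t^r\<close> in a product of binomial series.\<close>

lemma lauricella_FD_terminating:
  assumes "m > 0"
  shows "lauricella_FD (- of_nat d) (\<lambda>_. b) c m x =
    (\<Sum>r=0..d. pochhammer (- of_nat d) r / pochhammer c r * fps_nth (\<Prod>i<m. negbin b (x i)) r)"
proof -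
  define T where "T ms = pochhammer (- of_nat d) (sum_list ms) * (\<Prod>i<m. pochhammer b (ms ! i))
      / (pochhammer c (sum_list ms) * (\<Prod>i<m. fact (ms ! i))) * (\<Prod>i<m. x i ^ (ms ! i))" for ms
  define S where "S = (\<Union>r\<in>{0..d}. natpermute r m)"
  have "lauricella_FD (- of_nat d) (\<lambda>_. b) c m x = infsum T {ms. length ms = m}"
    unfolding lauricella_FD_def T_def ..
  also have "\<dots> = infsum T S"
  proof (rule infsum_cong_neutral)
    fix ms assume "ms \<in> {ms. length ms = m} - S"
    then have "sum_list ms > d" by (auto simp: S_def natpermute_def)
    then show "T ms = 0" by (simp add: T_def pochhammer_of_nat_eq_0_lemma)
  qed (auto simp: S_def natpermute_def)
  also have "\<dots> = sum T S" by (rule infsum_finite) (simp add: S_def natpermute_finite)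
  also have "\<dots> = (\<Sum>r=0..d. sum T (natpermute r m))"
    unfolding S_def by (rule sum.UNION_disjoint) (auto simp: natpermute_finite, auto simp: natpermute_def)
  also have "\<dots> = (\<Sum>r=0..d. pochhammer (- of_nat d) r / pochhammer c r * fps_nth (\<Prod>i<m. negbin b (x i)) r)"
    unfolding fps_prod_nth_lessThan[OF assms] sum_distrib_left
    by (intro sum.cong refl) (auto simp: T_def natpermute_def negbin_nth prod.distrib prod_dividef)
  finally show ?thesis .
qed

text \<open>The \<open>r\<close>-th terms agree with those of
  \<open>negbin_prod_one_minus_nth\<close> for \<open>y i = 1 - x i\<close>. The second assumption
  keeps the denominators \<open>pochhammer c r\<close> away from zero.\<close>

lemma lauricella_FD_one_minus:
  fixes a :: complex
  assumes "m > 0" and "\<And>j. of_nat (Suc m) * a \<noteq> - of_nat j"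
  shows "pochhammer (of_nat (Suc m) * a) d / fact d *
      lauricella_FD (- of_nat d) (\<lambda>_. a) (of_nat (Suc m) * a) m (\<lambda>i. 1 - x i)
     = fps_nth (negbin a 1 * (\<Prod>i<m. negbin a (x i))) d"
proof -
  define c where "c = of_nat (Suc m) * a"
  have "pochhammer c d / fact d * (pochhammer (- of_nat d) r / pochhammer c r)
     = (-1) ^ r * pochhammer (c + of_nat r) (d - r) / fact (d - r)" if "r \<le> d" for r
  proof -
    have "pochhammer c r \<noteq> 0" using assms(2) by (auto simp: pochhammer_eq_0_iff c_def)
    then show ?thesis using that
      by (simp add: pochhammer_product[OF that, of c] pochhammer_minus_of_nat[OF that] field_simps)
  qed
  then have "pochhammer c d / fact d * lauricella_FD (- of_nat d) (\<lambda>_. a) c m (\<lambda>i. 1 - x i)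
     = (\<Sum>r=0..d. (-1) ^ r * pochhammer (c + of_nat r) (d - r) / fact (d - r)
          * fps_nth (\<Prod>i<m. negbin a (1 - x i)) r)"
    unfolding lauricella_FD_terminating[OF assms(1)] sum_distrib_left mult.assoc[symmetric]
    by (intro sum.cong refl) simp
  then show ?thesis
    using negbin_prod_one_minus_nth[of "{..<m}" a "\<lambda>i. 1 - x i" d] by (simp add: c_def)
qed

text \<open>The right-hand side is a Cauchy product with coefficients
  \<open>(a)_(d-r) / (d-r)!\<close> of the separate factor. Reversing the Pochhammer product
  \<open>(a)_d\<close> writes them with lower parameter \<open>- d - a + 1\<close>.\<close>

lemma lauricella_FD_reverse:
  fixes a :: complex
  assumes "m > 0" and "\<And>j. a \<noteq> - of_nat j"
  shows "pochhammer a d / fact d * lauricella_FD (- of_nat d) (\<lambda>_. a) (- of_nat d - a + 1) m x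
     = fps_nth (negbin a 1 * (\<Prod>i<m. negbin a (x i))) d"
proof -
  have "pochhammer a d / fact d * (pochhammer (- of_nat d) r / pochhammer (- of_nat d - a + 1) r)
     = pochhammer a (d - r) / fact (d - r)" if "r \<le> d" for r
  proof -
    have nz: "pochhammer a d \<noteq> 0" using assms(2) by (auto simp: pochhammer_eq_0_iff)
    have "pochhammer (- (a + of_nat d - 1)) r = (-1) ^ r * pochhammer (a + of_nat (d - r)) r"
      unfolding pochhammer_minus using that by (simp add: of_nat_diff algebra_simps)
    then have "pochhammer (- of_nat d - a + 1) r = (-1) ^ r * pochhammer (a + of_nat (d - r)) r"
      by (simp add: algebra_simps)
    moreover have "pochhammer a d = pochhammer a (d - r) * pochhammer (a + of_nat (d - r)) r"
      using pochhammer_product[of "d - r" d a] that by simp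
    ultimately show ?thesis using nz 
      by (simp add: pochhammer_minus_of_nat[OF that] field_simps)
  qed
  then have "pochhammer a d / fact d * lauricella_FD (- of_nat d) (\<lambda>_. a) (- of_nat d - a + 1) m x
     = (\<Sum>r=0..d. pochhammer a (d - r) / fact (d - r) * fps_nth (\<Prod>i<m. negbin a (x i)) r)"
    unfolding lauricella_FD_terminating[OF assms(1)] sum_distrib_left mult.assoc[symmetric]
    by (intro sum.cong refl) simp
  then show ?thesis
    unfolding mult.commute[of "negbin a 1"] fps_mult_nth by (simp add: negbin_nth mult.commute)
qed

section \<open>Uniqueness of eigenfunctions of \<open>L_op\<close>\<close>

text \<open>An equality of functions rather than of values, so that it can be applied twice to
  evaluate \<open>theta i (theta i f)\<close>.\<close>

lemma theta_sum_monomials: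
  assumes "i < n"
  shows "theta i (\<lambda>z. \<Sum>s\<in>S. c s * (\<Prod>j<n. z j ^ e s j)) =
     (\<lambda>z. \<Sum>s\<in>S. of_nat (e s i) * c s * (\<Prod>j<n. z j ^ e s j))"
proof
  fix z :: "nat \<Rightarrow> complex"
  have split: "(\<Prod>j<n. (z(i := t)) j ^ e s j) = t ^ e s i * (\<Prod>j\<in>{..<n} - {i}. z j ^ e s j)" for s t
    using assms by (subst prod.remove[of _ i]) auto
  have "((\<lambda>t. \<Sum>s\<in>S. c s * (\<Prod>j<n. (z(i := t)) j ^ e s j)) has_field_derivative
      (\<Sum>s\<in>S. c s * (of_nat (e s i) * z i ^ (e s i - 1) * (\<Prod>j\<in>{..<n} - {i}. z j ^ e s j)))) (at (z i))"
    unfolding split by (auto intro!: derivative_eq_intros sum.cong simp: mult_ac)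
  moreover have "z i * (\<Sum>s\<in>S. c s * (of_nat (e s i) * z i ^ (e s i - 1) * (\<Prod>j\<in>{..<n} - {i}. z j ^ e s j)))
     = (\<Sum>s\<in>S. of_nat (e s i) * c s * (z i ^ e s i * (\<Prod>j\<in>{..<n} - {i}. z j ^ e s j)))"
    unfolding sum_distrib_left
  proof (rule sum.cong[OF refl])
    fix s
    \<comment> \<open>For exponent 0 the truncated \<open>e s i - 1\<close> is harmless, because the
      factor \<open>of_nat (e s i)\<close> is zero; otherwise \<open>z i\<close> restores the lost
      power.\<close>
    show "z i * (c s * (of_nat (e s i) * z i ^ (e s i - 1) * (\<Prod>j\<in>{..<n} - {i}. z j ^ e s j)))
      = of_nat (e s i) * c s * (z i ^ e s i * (\<Prod>j\<in>{..<n} - {i}. z j ^ e s j))"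
      by (cases "e s i") simp_all
  qed
  moreover have "(\<Prod>j<n. z j ^ e s j) = z i ^ e s i * (\<Prod>j\<in>{..<n} - {i}. z j ^ e s j)" for s
    using split[of "z i" s] by simp
  ultimately show "theta i (\<lambda>z. \<Sum>s\<in>S. c s * (\<Prod>j<n. z j ^ e s j)) z =
      (\<Sum>s\<in>S. of_nat (e s i) * c s * (\<Prod>j<n. z j ^ e s j))"
    by (simp add: theta_def DERIV_imp_deriv)
qed

text \<open>The factor by which \<open>L_op\<close> multiplies the monomial with exponents \<open>e\<close>.\<close>

definition L_symbol :: "nat \<Rightarrow> real \<Rightarrow> (nat \<Rightarrow> complex) \<Rightarrow> (nat \<Rightarrow> nat) \<Rightarrow> complex" where
  "L_symbol n k z e = (\<Sum>i<n. of_nat (e i) ^ 2)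
     + of_real k * (\<Sum>i<n. \<Sum>j\<in>{i<..<n}. (z i + z j) / (z i - z j) * (of_nat (e i) - of_nat (e j)))"

lemma L_op_sum_monomials:
  "L_op n k (\<lambda>z. \<Sum>s\<in>S. c s * (\<Prod>j<n. z j ^ e s j)) z =
     (\<Sum>s\<in>S. L_symbol n k z (e s) * (c s * (\<Prod>j<n. z j ^ e s j)))"
proof -
  define f where "f = (\<lambda>z. \<Sum>s\<in>S. c s * (\<Prod>j<n. z j ^ e s j))"
  define M where "M s = c s * (\<Prod>j<n. z j ^ e s j)" for s
  have th: "theta i f z = (\<Sum>s\<in>S. of_nat (e s i) * M s)" if "i < n" for i
    using that by (simp add: f_def theta_sum_monomials M_def mult_ac)
  have "theta i (theta i f) z = (\<Sum>s\<in>S. of_nat (e s i) ^ 2 * M s)" if "i < n" for i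
    unfolding f_def theta_sum_monomials[OF that] M_def
    by (simp add: power2_eq_square mult_ac)
  then have 1: "(\<Sum>i<n. theta i (theta i f) z) = (\<Sum>s\<in>S. (\<Sum>i<n. of_nat (e s i) ^ 2) * M s)"
    by (simp add: sum_distrib_right sum.swap[of _ S])
  have "(\<Sum>i<n. \<Sum>j\<in>{i<..<n}. (z i + z j) / (z i - z j) * (theta i f z - theta j f z))
     = (\<Sum>i<n. \<Sum>j\<in>{i<..<n}. \<Sum>s\<in>S. (z i + z j) / (z i - z j) * (of_nat (e s i) - of_nat (e s j)) * M s)"
  proof (intro sum.cong refl)
    fix i j assume "i \<in> {..<n}" "j \<in> {i<..<n}"
    then have "i < n" "j < n" by auto
    then show "(z i + z j) / (z i - z j) * (theta i f z - theta j f z)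
      = (\<Sum>s\<in>S. (z i + z j) / (z i - z j) * (of_nat (e s i) - of_nat (e s j)) * M s)"
      by (simp only: th sum_subtractf[symmetric] sum_distrib_left left_diff_distrib[symmetric] mult.assoc)
  qed
  also have "\<dots> = (\<Sum>s\<in>S. (\<Sum>i<n. \<Sum>j\<in>{i<..<n}. (z i + z j) / (z i - z j) * (of_nat (e s i) - of_nat (e s j))) * M s)"
    by (simp only: sum_distrib_right sum.swap[of _ S])
  finally have 2: "(\<Sum>i<n. \<Sum>j\<in>{i<..<n}. (z i + z j) / (z i - z j) * (theta i f z - theta j f z)) = \<dots>" .
  show ?thesis
    unfolding L_op_def f_def[symmetric] M_def[symmetric] L_symbol_def 1 2
    by (simp only: sum.distrib distrib_right mult.assoc sum_distrib_left[symmetric])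
qed

section \<open>Sums over pairs of indices\<close>

lemma sum_pairs_Suc:
  "(\<Sum>i<Suc n. \<Sum>j\<in>{i<..<Suc n}. g i j) = (\<Sum>i<n. \<Sum>j\<in>{i<..<n}. g i j) + (\<Sum>i<n. g i n)"
  for g :: "nat \<Rightarrow> nat \<Rightarrow> 'a::comm_monoid_add"
proof -
  have "{i<..<Suc n} = insert n {i<..<n}" if "i < n" for i using that by auto
  then have "(\<Sum>i<n. \<Sum>j\<in>{i<..<Suc n}. g i j) = (\<Sum>i<n. (\<Sum>j\<in>{i<..<n}. g i j) + g i n)"
    by (intro sum.cong refl) (simp add: add.commute)
  moreover have "{n<..<Suc n} = {}" by auto
  ultimately show ?thesis by (simp add: sum.distrib)
qed

text \<open>Index \<open>i\<close> is the smaller member of \<open>n - 1 - i\<close> pairs and the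
  larger member of \<open>i\<close> pairs. This yields the linear part of
  \<open>h_eig\<close>.\<close>

lemma sum_pairs_diff:
  "(\<Sum>i<n. \<Sum>j\<in>{i<..<n}. a i - a j) = (\<Sum>i<n. a i * (of_nat n - 1 - 2 * of_nat i))"
  for a :: "nat \<Rightarrow> 'a::comm_ring_1"
proof (induction n)
  case (Suc n)
  have "(\<Sum>i<n. a i * (of_nat (Suc n) - 1 - 2 * of_nat i)) = (\<Sum>i<n. a i * (of_nat n - 1 - 2 * of_nat i)) + (\<Sum>i<n. a i)"
    by (simp add: sum.distrib[symmetric] algebra_simps)
  then show ?case unfolding sum_pairs_Suc Suc by (simp add: sum_subtractf algebra_simps)
qed simp

lemma sum_pairs_add:
  "(\<Sum>i<n. \<Sum>j\<in>{i<..<n}. a i + a j) = (of_nat n - 1) * (\<Sum>i<n. a i)"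
  for a :: "nat \<Rightarrow> 'a::comm_ring_1"
proof (induction n)
  case (Suc n)
  show ?case unfolding sum_pairs_Suc Suc by (simp add: sum.distrib algebra_simps)
qed simp

lemma sum_squared_pairs:
  "(\<Sum>i<n. a i)\<^sup>2 = (\<Sum>i<n. (a i)\<^sup>2) + 2 * (\<Sum>i<n. \<Sum>j\<in>{i<..<n}. a i * a j)"
  for a :: "nat \<Rightarrow> 'a::comm_ring_1"
proof (induction n)
  case (Suc n)
  have "(\<Sum>i<Suc n. a i)\<^sup>2 = (\<Sum>i<n. a i)\<^sup>2 + (a n)\<^sup>2 + 2 * (\<Sum>i<n. a i * a n)"
    by (simp add: power2_sum mult.assoc flip: sum_distrib_right)
  then show ?case unfolding sum_pairs_Suc Suc by (simp add: algebra_simps)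
qed simp

text \<open>On the curve z_i = t^(B^(n-1-i)) the monomial with exponent list \<open>s\<close>
  restricts to t^(radix B s). The first entry is the leading digit.\<close>

fun radix :: "nat \<Rightarrow> nat list \<Rightarrow> nat" where
  "radix B [] = 0"
| "radix B (a # as) = a * B ^ length as + radix B as"

lemma radix_less: "(\<And>a. a \<in> set as \<Longrightarrow> a < B) \<Longrightarrow> radix B as < B ^ length as"
proof (induction as)
  case (Cons a as)
  then have "Suc a * B ^ length as \<le> B * B ^ length as"
    by (intro mult_right_mono) (auto simp: Suc_le_eq)
  moreover have "radix B as < B ^ length as" using Cons by auto
  ultimately show ?case by simp
qed simp

lemma radix_inj:
  assumes "length as = length bs" "\<And>a. a \<in> set as \<union> set bs \<Longrightarrow> a < B" "radix B as = radix B bs"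
  shows "as = bs"
  using assms
proof (induction as bs rule: list_induct2)
  case (Cons a as b bs)
  define N where "N = B ^ length as"
  have l: "radix B as < N" "radix B bs < N"
    unfolding N_def using radix_less[of as B] radix_less[of bs B] Cons by auto
  have e: "a * N + radix B as = b * N + radix B bs"
    using Cons by (simp add: N_def)
  have "a = (a * N + radix B as) div N"
    using l by simp
  also have "\<dots> = b" unfolding e using l by simp
  finally have "a = b" .
  with Cons e show ?case by auto
qed simp

lemma radix_eq_sum: "radix B as = (\<Sum>i<length as. B ^ (length as - 1 - i) * as ! i)"
  by (induction as) (simp_all add: sum.lessThan_Suc_shift mult.commute del: sum.lessThan_Suc)

text \<open>For \<open>i < j\<close> the ratio z_j / z_i tends to 0 along the curve, so each (z_i +
  z_j) / (z_i - z_j) tends to 1 and the dependence on the point disappears.\<close>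

lemma tendsto_L_symbol:
  assumes "\<And>i j. i < j \<Longrightarrow> j < n \<Longrightarrow> (W j :: nat) < W i"
  shows "((\<lambda>t. L_symbol n k (\<lambda>i. of_real t ^ W i) e) \<longlongrightarrow>
     of_real ((\<Sum>i<n. real (e i) ^ 2) + k * (\<Sum>i<n. \<Sum>j\<in>{i<..<n}. real (e i) - real (e j)))) at_top"
proof -
  have r: "((\<lambda>t. (of_real t ^ W i + of_real t ^ W j) / (of_real t ^ W i - of_real t ^ W j) :: complex) \<longlongrightarrow> 1) at_top"
    if "i < j" "j < n" for i j
  proof -
    define D where "D = W i - W j"
    have D: "D > 0" "W i = W j + D" using assms[OF that] by (auto simp: D_def)
    have i: "((\<lambda>t::real. inverse (of_real t ^ D) :: complex) \<longlongrightarrow> 0) at_top"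
    proof -
      have "((\<lambda>t::real. inverse (t ^ D)) \<longlongrightarrow> 0) at_top"
        using D by (intro tendsto_inverse_0_at_top filterlim_pow_at_top filterlim_ident)
      from tendsto_of_real[OF this, where 'a=complex] show ?thesis by simp
    qed
    have "((\<lambda>t. (1 + inverse (of_real t ^ D)) / (1 - inverse (of_real t ^ D)) :: complex) \<longlongrightarrow> (1 + 0) / (1 - 0)) at_top"
      by (intro tendsto_intros i) auto
    moreover have "eventually (\<lambda>t. (1 + inverse (of_real t ^ D)) / (1 - inverse (of_real t ^ D)) =
       (of_real t ^ W i + of_real t ^ W j) / (of_real t ^ W i - of_real t ^ W j :: complex)) at_top"
      using eventually_gt_at_top[of 0]
    proof eventually_elim
      case (elim t)
      define u :: complex where "u = of_real t"
      have u: "u \<noteq> 0" "u ^ W j / u ^ W i = inverse (u ^ D)"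
        using elim by (auto simp: u_def D power_add field_simps)
      have "(u ^ W i + u ^ W j) / (u ^ W i - u ^ W j) = ((u ^ W i + u ^ W j) / u ^ W i) / ((u ^ W i - u ^ W j) / u ^ W i)"
        using u by simp
      also have "\<dots> = (1 + inverse (u ^ D)) / (1 - inverse (u ^ D))"
        using u by (simp add: add_divide_distrib diff_divide_distrib)
      finally show ?case by (simp add: u_def)
    qed
    ultimately show ?thesis by (auto intro: Lim_transform_eventually)
  qed
  have "((\<lambda>t. L_symbol n k (\<lambda>i. of_real t ^ W i) e) \<longlongrightarrow>
    (\<Sum>i<n. of_nat (e i) ^ 2) + of_real k * (\<Sum>i<n. \<Sum>j\<in>{i<..<n}. 1 * (of_nat (e i) - of_nat (e j)))) at_top"
    unfolding L_symbol_def by (intro tendsto_intros r) auto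
  then show ?thesis by simp
qed

text \<open>Along the curve \<open>z\<^sub>i = t^(B^(n-1-i))\<close> with \<open>B\<close> large, distinct exponent vectors give
  distinct powers of \<open>t\<close>, so dividing by the dominant one and letting \<open>t \<rightarrow> \<infinity>\<close> isolates a
  single coefficient, on which the operator acts by the scalar \<open>h_eig\<close>.\<close>

lemma L_op_eigenfunction_unique:
  assumes fin: "finite S" and len: "\<And>s. s \<in> S \<Longrightarrow> length s = n"
    and eig: "\<And>z. \<forall>i<n. \<forall>j<n. i \<noteq> j \<longrightarrow> z i \<noteq> z j \<Longrightarrow>
       (\<Sum>s\<in>S. L_symbol n k z (nth s) * (c s * (\<Prod>j<n. z j ^ (s ! j))))
         = of_real E * (\<Sum>s\<in>S. c s * (\<Prod>j<n. z j ^ (s ! j)))"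
    and E: "\<And>s. s \<in> S \<Longrightarrow> c s \<noteq> 0 \<Longrightarrow> h_eig n k s \<noteq> E"
    and s: "s \<in> S"
  shows "c s = 0"
proof (rule ccontr)
  assume "c s \<noteq> 0"
  \<comment> \<open>\<open>B\<close> exceeds all entries, so that \<open>radix B\<close> is
    injective on \<open>S\<close>. The \<open>insert 0\<close> keeps the maximum defined, and the
    second \<open>Suc\<close> gives \<open>B > 1\<close>, which makes the weights \<open>W\<close>
    strictly decreasing.\<close>
  define B where "B = Suc (Suc (Max (insert 0 (\<Union>(set ` S)))))"
  have B: "a < B" if "a \<in> set s" "s \<in> S" for a s
    using that fin by (auto simp: B_def less_Suc_eq_le intro!: Max_ge le_SucI)
  define W where "W i = B ^ (n - 1 - i)" for i
  have W: "W j < W i" if "i < j" "j < n" for i j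
    using that unfolding W_def by (intro power_strict_increasing) (auto simp: B_def)
  \<comment> \<open>Passing to the support guarantees that the dominant exponent list
    \<open>u\<close> chosen below has a nonzero coefficient.\<close>
  define T where "T = {s\<in>S. c s \<noteq> 0}"
  have T: "finite T" "T \<noteq> {}" using fin s \<open>c s \<noteq> 0\<close> by (auto simp: T_def)
  define M where "M = Max (radix B ` T)"
  have "M \<in> radix B ` T" unfolding M_def using T by (intro Max_in) auto
  then obtain u where u: "u \<in> T" "radix B u = M" by auto
  have lt: "radix B v < M" if "v \<in> T" "v \<noteq> u" for v
  proof -
    have "radix B v \<le> M" unfolding M_def using T that by auto
    moreover have "radix B v \<noteq> radix B u"
    proof
      assume "radix B v = radix B u"
      then have "v = u" using that u len B by (intro radix_inj[of v u B]) (auto simp: T_def)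
      with that show False by simp
    qed
    ultimately show ?thesis using u by simp
  qed
  have mono: "(\<Prod>j<n. (x ^ W j) ^ (v ! j)) = x ^ radix B v" if "v \<in> T" for v and x :: complex
    using len[of v] that
    by (simp add: T_def radix_eq_sum W_def power_sum flip: power_mult)
  \<comment> \<open>This is the eigenvalue equation on the curve, divided by \<open>t^M\<close>. For
    \<open>t > 1\<close> the coordinates are distinct because the exponents \<open>W i\<close>
    are.\<close>
  have ev: "eventually (\<lambda>t. (\<Sum>v\<in>T. (L_symbol n k (\<lambda>i. of_real t ^ W i) (nth v) - of_real E) * c v
      * (of_real t ^ radix B v / of_real t ^ M)) = 0) at_top"
    using eventually_gt_at_top[of 1]
  proof eventually_elim
    case (elim t)
    define x :: complex where "x = of_real t"
    have "x ^ W i \<noteq> x ^ W j" if "i < n" "j < n" "i \<noteq> j" for i j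
    proof
      assume "x ^ W i = x ^ W j"
      then have "complex_of_real (t ^ W i) = of_real (t ^ W j)" by (simp add: x_def)
      then have "t ^ W i = t ^ W j" by (simp only: of_real_eq_iff)
      then have "W i = W j" using elim by (simp add: power_inject_exp)
      with W[of i j] W[of j i] that show False by (cases i j rule: linorder_cases) auto
    qed
    then have "\<forall>i<n. \<forall>j<n. i \<noteq> j \<longrightarrow> x ^ W i \<noteq> x ^ W j" by blast
    from eig[OF this]
    have "(\<Sum>s\<in>S. (L_symbol n k (\<lambda>i. x ^ W i) (nth s) - of_real E) * (c s * (\<Prod>j<n. (x ^ W j) ^ (s ! j)))) = 0"
      by (simp add: left_diff_distrib sum_subtractf sum_distrib_left)
    also have "(\<Sum>s\<in>S. (L_symbol n k (\<lambda>i. x ^ W i) (nth s) - of_real E) * (c s * (\<Prod>j<n. (x ^ W j) ^ (s ! j))))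
      = (\<Sum>v\<in>T. (L_symbol n k (\<lambda>i. x ^ W i) (nth v) - of_real E) * (c v * (\<Prod>j<n. (x ^ W j) ^ (v ! j))))"
      by (rule sum.mono_neutral_right) (use fin in \<open>auto simp: T_def\<close>)
    finally have "(\<Sum>v\<in>T. (L_symbol n k (\<lambda>i. x ^ W i) (nth v) - of_real E) * (c v * x ^ radix B v)) = 0"
      by (simp add: mono)
    then have "(\<Sum>v\<in>T. (L_symbol n k (\<lambda>i. x ^ W i) (nth v) - of_real E) * (c v * x ^ radix B v)) / x ^ M = 0" by simp
    then show ?case unfolding sum_divide_distrib x_def by (simp add: mult_ac)
  qed
  define h where "h v = (\<Sum>i<n. real (v ! i) ^ 2) + k * (\<Sum>i<n. \<Sum>j\<in>{i<..<n}. real (v ! i) - real (v ! j))" for v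
  have h: "h v = h_eig n k v" for v
    unfolding h_def sum_pairs_diff h_eig_def
    by (simp add: sum.distrib sum_distrib_left power2_eq_square distrib_left mult_ac)
  have lim: "((\<lambda>t::real. of_real t ^ radix B v / of_real t ^ M :: complex) \<longlongrightarrow> (if v = u then 1 else 0)) at_top"
    if "v \<in> T" for v
  proof (cases "v = u")
    case True
    have "eventually (\<lambda>t::real. 1 = (of_real t ^ radix B v / of_real t ^ M :: complex)) at_top"
      using eventually_gt_at_top[of 0] by eventually_elim (use True u in auto)
    from Lim_transform_eventually[OF tendsto_const this] True show ?thesis by simp
  next
    case False
    define D where "D = M - radix B v"
    have D: "D > 0" "M = radix B v + D" using lt[OF that False] by (auto simp: D_def)
    have "((\<lambda>t::real. inverse (t ^ D)) \<longlongrightarrow> 0) at_top"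
      using D by (intro tendsto_inverse_0_at_top filterlim_pow_at_top filterlim_ident)
    from tendsto_of_real[OF this, where 'a=complex]
    have "((\<lambda>t::real. inverse (of_real t ^ D) :: complex) \<longlongrightarrow> 0) at_top" by simp
    moreover have "eventually (\<lambda>t::real. inverse (of_real t ^ D) = (of_real t ^ radix B v / of_real t ^ M :: complex)) at_top"
      using eventually_gt_at_top[of 0] by eventually_elim (auto simp: D power_add field_simps)
    ultimately show ?thesis using False by (auto intro: Lim_transform_eventually)
  qed
  \<comment> \<open>Only the term of \<open>u\<close> survives in the limit, whereas by
    \<open>ev\<close> the limit is 0; hence \<open>(h u - E) * c u = 0\<close>.\<close>
  have "((\<lambda>t. \<Sum>v\<in>T. (L_symbol n k (\<lambda>i. of_real t ^ W i) (nth v) - of_real E) * c v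
      * (of_real t ^ radix B v / of_real t ^ M)) \<longlongrightarrow> (\<Sum>v\<in>T. (of_real (h v) - of_real E) * c v * (if v = u then 1 else 0))) at_top"
    unfolding h_def by (intro tendsto_sum tendsto_mult tendsto_diff tendsto_const tendsto_L_symbol lim) (use W in auto)
  from Lim_transform_eventually[OF this ev]
  have "(\<Sum>v\<in>T. (of_real (h v) - of_real E) * c v * (if v = u then 1 else 0)) = 0"
    by (simp only: tendsto_const_iff trivial_limit_at_top_linorder not_False_eq_True)
  then have "(\<Sum>v\<in>T. if v = u then (of_real (h v) - of_real E) * c v else 0) = 0"
    by (simp only: if_distrib[of "\<lambda>x. _ * x"] mult_1_right mult_zero_right)
  then have "(of_real (h u) - of_real E) * c u = 0" using u T by simp
  then have "c u = 0 \<or> h u = E" by auto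
  then show False using E[of u] u(1) h by (auto simp: T_def)
qed

section \<open>An eigenfunction of \<open>L_op\<close>\<close>

lemma fps_nth_X_deriv: "fps_nth (fps_X * fps_deriv f) m = of_nat m * fps_nth f m"
  for f :: "'a::field_char_0 fps"
  by (cases m) simp_all

text \<open>Read at a power of \<open>t\<close>, this identity turns the quotients \<open>(z\<^sub>i + z\<^sub>j)/(z\<^sub>i - z\<^sub>j)\<close> occurring
  in \<open>L_op\<close> into polynomial multipliers of the coefficients.\<close>

lemma negbin_pair:
  fixes a u v :: "'a::field_char_0"
  defines "D \<equiv> \<lambda>x. fps_X * fps_deriv (negbin a x)"
  shows "fps_const (a * v) * (D u * negbin a v) - fps_const (a * u) * (negbin a u * D v)
     = fps_const (u - v) * (D u * D v)"
proof -
  have D: "(1 - fps_const x * fps_X) * D x = fps_X * (fps_const (a * x) * negbin a x)" for x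
    unfolding D_def negbin_deriv[symmetric] by (simp add: mult_ac)
  \<comment> \<open>The differential equation expresses \<open>t * a * x * negbin a x\<close>
    through \<open>D x\<close>, so the identity is first proved with an extra factor
    \<open>t\<close>, which is then cancelled.\<close>
  have "fps_X * (fps_const (a * v) * (D u * negbin a v) - fps_const (a * u) * (negbin a u * D v))
     = D u * (fps_X * (fps_const (a * v) * negbin a v)) - fps_X * (fps_const (a * u) * negbin a u) * D v"
    by (simp add: algebra_simps)
  also have "\<dots> = fps_X * (fps_const (u - v) * (D u * D v))"
    unfolding D[symmetric] by (simp add: algebra_simps flip: fps_const_sub)
  finally show ?thesis by simp
qed

text \<open>The operator t d/dt multiplies the coefficient of t^m by m, so a weight
  \<open>v ! i\<close> amounts to applying it to the \<open>i\<close>-th factor alone.\<close>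

lemma sum_natpermute_weighted:
  fixes A :: "nat \<Rightarrow> 'a::field_char_0 fps"
  assumes "n > 0" "I \<subseteq> {..<n}"
  shows "(\<Sum>v\<in>natpermute d n. (\<Prod>i\<in>I. of_nat (v ! i)) * (\<Prod>l<n. fps_nth (A l) (v ! l)))
     = fps_nth (\<Prod>l<n. if l \<in> I then fps_X * fps_deriv (A l) else A l) d"
proof -
  have I: "(\<Prod>i\<in>I. of_nat (v ! i)) = (\<Prod>l<n. if l \<in> I then of_nat (v ! l) else 1 :: 'a)" for v
    using assms(2) by (simp add: prod.If_cases Int_absorb1)
  show ?thesis
    unfolding fps_prod_nth_lessThan[OF assms(1)] I prod.distrib[symmetric]
    by (intro sum.cong prod.cong refl) (simp add: fps_nth_X_deriv)
qed

text \<open>The sums weighted by \<open>v ! i\<close>, by \<open>v ! j\<close> and by their product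
  are coefficients of three products of series. Multiplying \<open>negbin_pair\<close> by the
  factors of the other variables gives a linear relation between them, which absorbs the
  denominator. The equality holds for the sums, not term by term.\<close>

lemma negbin_coefficients_pair:
  fixes a :: "'a::field_char_0" and z :: "nat \<Rightarrow> 'a"
  assumes ij: "i < n" "j < n" "i \<noteq> j" and z: "z i \<noteq> z j"
  defines "m \<equiv> \<lambda>v. \<Prod>l<n. fps_nth (negbin a (z l)) (v ! l)"
  shows "(\<Sum>v\<in>natpermute d n. a * ((z i + z j) / (z i - z j) * (of_nat (v ! i) - of_nat (v ! j))) * m v)
    = (\<Sum>v\<in>natpermute d n. (a * (of_nat (v ! i) + of_nat (v ! j)) + 2 * (of_nat (v ! i) * of_nat (v ! j))) * m v)"
proof -
  define Si where "Si = (\<Sum>v\<in>natpermute d n. of_nat (v ! i) * m v)"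
  define Sj where "Sj = (\<Sum>v\<in>natpermute d n. of_nat (v ! j) * m v)"
  define Sij where "Sij = (\<Sum>v\<in>natpermute d n. of_nat (v ! i) * of_nat (v ! j) * m v)"
  define D where "D x = fps_X * fps_deriv (negbin a x)" for x
  define R where "R = (\<Prod>l\<in>{..<n} - {i} - {j}. negbin a (z l))"
  have split: "(\<Prod>l<n. F l) = F i * (F j * (\<Prod>l\<in>{..<n} - {i} - {j}. F l))" for F :: "nat \<Rightarrow> 'a fps"
    using ij by (simp add: prod.remove[of "{..<n}" i] prod.remove[of "{..<n} - {i}" j])
  have n: "n > 0" using ij by simp
  have "Si = fps_nth (D (z i) * negbin a (z j) * R) d"
    using sum_natpermute_weighted[OF n, of "{i}" "\<lambda>l. negbin a (z l)" d] ij
    unfolding split by (simp add: Si_def m_def D_def R_def mult.assoc)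
  moreover have "Sj = fps_nth (negbin a (z i) * D (z j) * R) d"
    using sum_natpermute_weighted[OF n, of "{j}" "\<lambda>l. negbin a (z l)" d] ij
    unfolding split by (simp add: Sj_def m_def D_def R_def mult.assoc)
  moreover have "Sij = fps_nth (D (z i) * D (z j) * R) d"
    using sum_natpermute_weighted[OF n, of "{i, j}" "\<lambda>l. negbin a (z l)" d] ij
    unfolding split by (simp add: Sij_def m_def D_def R_def mult.assoc)
  moreover have "fps_const (a * z j) * (D (z i) * negbin a (z j) * R) - fps_const (a * z i) * (negbin a (z i) * D (z j) * R)
    = fps_const (z i - z j) * (D (z i) * D (z j) * R)"
    using arg_cong[OF negbin_pair[of a "z j" "z i"], of "\<lambda>x. x * R"]
    unfolding D_def[symmetric] by (simp only: left_diff_distrib mult.assoc)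
  from arg_cong[OF this, of "\<lambda>f. fps_nth f d"]
  have "a * z j * fps_nth (D (z i) * negbin a (z j) * R) d - a * z i * fps_nth (negbin a (z i) * D (z j) * R) d
     = (z i - z j) * fps_nth (D (z i) * D (z j) * R) d"
    by (simp only: fps_sub_nth fps_mult_left_const_nth)
  ultimately have key: "a * z j * Si - a * z i * Sj = (z i - z j) * Sij" by simp
  have "(z i - z j) * (a * ((z i + z j) / (z i - z j) * (Si - Sj))) = a * (z i + z j) * (Si - Sj)"
    using z by simp
  \<comment> \<open>The splitting is chosen so that the second summand is twice the left-hand side
    of \<open>key\<close>.\<close>
  also have "\<dots> = (z i - z j) * (a * (Si + Sj)) + 2 * (a * z j * Si - a * z i * Sj)"
    by (simp add: algebra_simps)
  also have "\<dots> = (z i - z j) * (a * (Si + Sj) + 2 * Sij)"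
    unfolding key by (simp add: algebra_simps)
  finally have "a * ((z i + z j) / (z i - z j) * (Si - Sj)) = a * (Si + Sj) + 2 * Sij"
    using z by simp
  moreover have "(\<Sum>v\<in>natpermute d n. a * ((z i + z j) / (z i - z j) * (of_nat (v ! i) - of_nat (v ! j))) * m v)
     = a * ((z i + z j) / (z i - z j) * (Si - Sj))"
    unfolding Si_def Sj_def sum_subtractf[symmetric] sum_distrib_left left_diff_distrib[symmetric]
    by (simp only: mult.assoc)
  moreover have "(\<Sum>v\<in>natpermute d n. (a * (of_nat (v ! i) + of_nat (v ! j)) + 2 * (of_nat (v ! i) * of_nat (v ! j))) * m v)
     = a * (Si + Sj) + 2 * Sij"
    unfolding Si_def Sj_def Sij_def sum_distrib_left sum.distrib[symmetric]
    by (intro sum.cong refl) (simp add: algebra_simps)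
  ultimately show ?thesis by simp
qed

lemma sum_natpermute: "v \<in> natpermute d n \<Longrightarrow> (\<Sum>i<n. of_nat (v ! i)) = (of_nat d :: 'a::semiring_1)"
  by (auto simp: natpermute_def sum_list_sum_nth atLeast0LessThan simp flip: of_nat_sum)

text \<open>Once the quotients are replaced by \<open>negbin_coefficients_pair\<close>, squares and
  doubled products combine to the square of the total, and the linear terms give
  \<open>k * (n - 1)\<close> times the total. As the total is always \<open>d\<close>, the
  multiplier is a scalar.\<close>

lemma L_symbol_negbin_coefficients:
  fixes z :: "nat \<Rightarrow> complex" and k :: real
  assumes z: "\<forall>i<n. \<forall>j<n. i \<noteq> j \<longrightarrow> z i \<noteq> z j"
  defines "m \<equiv> \<lambda>v. \<Prod>l<n. fps_nth (negbin (of_real k) (z l)) (v ! l)"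
  shows "(\<Sum>v\<in>natpermute d n. L_symbol n k z (nth v) * m v)
    = of_real (real d ^ 2 + k * (real n - 1) * real d) * (\<Sum>v\<in>natpermute d n. m v)"
proof -
  define V where "V = natpermute d n"
  define a :: complex where "a = of_real k"
  define X :: "nat list \<Rightarrow> complex" where "X v = (\<Sum>i<n. of_nat (v ! i) ^ 2)" for v
  define Y where "Y v = (\<Sum>i<n. \<Sum>j\<in>{i<..<n}. a * (of_nat (v ! i) + of_nat (v ! j)) + 2 * (of_nat (v ! i) * of_nat (v ! j)))" for v :: "nat list"
  have "(\<Sum>v\<in>V. L_symbol n k z (nth v) * m v) = (\<Sum>v\<in>V. (\<Sum>i<n. of_nat (v ! i) ^ 2) * m v)
     + (\<Sum>i<n. \<Sum>j\<in>{i<..<n}. \<Sum>v\<in>V. a * ((z i + z j) / (z i - z j) * (of_nat (v ! i) - of_nat (v ! j))) * m v)"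
    unfolding L_symbol_def a_def distrib_right sum.distrib sum_distrib_left sum_distrib_right sum.swap[of _ V] ..
  also have "(\<Sum>i<n. \<Sum>j\<in>{i<..<n}. \<Sum>v\<in>V. a * ((z i + z j) / (z i - z j) * (of_nat (v ! i) - of_nat (v ! j))) * m v)
     = (\<Sum>i<n. \<Sum>j\<in>{i<..<n}. \<Sum>v\<in>V. (a * (of_nat (v ! i) + of_nat (v ! j)) + 2 * (of_nat (v ! i) * of_nat (v ! j))) * m v)"
    unfolding V_def m_def a_def
    by (intro sum.cong refl negbin_coefficients_pair) (use z in auto)
  also have "\<dots> = (\<Sum>v\<in>V. (\<Sum>i<n. \<Sum>j\<in>{i<..<n}. a * (of_nat (v ! i) + of_nat (v ! j)) + 2 * (of_nat (v ! i) * of_nat (v ! j))) * m v)"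
    unfolding sum_distrib_right sum.swap[of _ V] ..
  finally have L: "(\<Sum>v\<in>V. L_symbol n k z (nth v) * m v) = (\<Sum>v\<in>V. X v * m v) + (\<Sum>v\<in>V. Y v * m v)"
    by (simp only: X_def Y_def)
  have "X v + Y v = of_real (real d ^ 2 + k * (real n - 1) * real d)" if "v \<in> V" for v
  proof -
    have d: "(\<Sum>i<n. of_nat (v ! i)) = (of_nat d :: complex)"
      using that unfolding V_def by (rule sum_natpermute)
    have "X v + Y v = (\<Sum>i<n. of_nat (v ! i) ^ 2) + 2 * (\<Sum>i<n. \<Sum>j\<in>{i<..<n}. of_nat (v ! i) * of_nat (v ! j))
        + a * (\<Sum>i<n. \<Sum>j\<in>{i<..<n}. of_nat (v ! i) + of_nat (v ! j))"
      unfolding X_def Y_def by (simp only: sum.distrib sum_distrib_left distrib_left add_ac)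
    also have "\<dots> = of_real (real d ^ 2 + k * (real n - 1) * real d)"
      unfolding sum_pairs_add sum_squared_pairs[symmetric] d by (simp add: a_def)
    finally show ?thesis .
  qed
  then show ?thesis
    unfolding V_def[symmetric] L sum.distrib[symmetric] distrib_right[symmetric] sum_distrib_left
    by (intro sum.cong refl) simp
qed

section \<open>Shifting all exponents by \<open>q\<close> and comparing eigenvalues\<close>

lemma L_symbol_shift:
  assumes "(\<Sum>i<n. e i) = d"
  shows "L_symbol n k z (\<lambda>i. q + e i) = L_symbol n k z e + of_nat (2 * q * d + n * q ^ 2)"
proof -
  have "(\<Sum>i<n. of_nat (q + e i) ^ 2) = ((\<Sum>i<n. of_nat (e i) ^ 2) + 2 * of_nat q * (\<Sum>i<n. of_nat (e i)) + of_nat n * of_nat q ^ 2 :: complex)"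
    by (simp add: power2_sum sum.distrib sum_distrib_left mult_ac)
  moreover have "(\<Sum>i<n. of_nat (e i)) = (of_nat d :: complex)" using assms by (simp flip: of_nat_sum)
  ultimately show ?thesis by (simp add: L_symbol_def)
qed

lemma L_symbol_cong: "(\<And>i. i < n \<Longrightarrow> e i = e' i) \<Longrightarrow> L_symbol n k z e = L_symbol n k z e'"
  unfolding L_symbol_def by (intro arg_cong2[of _ _ _ _ "(+)"] arg_cong2[of _ _ _ _ "(*)"] sum.cong refl) auto

text \<open>The eigenvalue is split into a part common to all \<open>v\<close> of total
  \<open>d\<close> and a subtracted deficit, whose two terms are non-negative when
  \<open>k > 0\<close>.\<close>

lemma h_eig_shift:
  assumes v: "v \<in> natpermute d n"
  shows "h_eig n k (map ((+) q) v) = real n * real q ^ 2 + 2 * real q * real d + real d ^ 2 + k * (real n - 1) * real d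
     - ((\<Sum>i<n. real (v ! i) * (real d - real (v ! i))) + 2 * k * (\<Sum>i<n. real i * real (v ! i)))"
proof -
  have len: "length v = n" using v by (simp add: natpermute_def)
  have d: "(\<Sum>i<n. real (v ! i)) = real d" using v by (rule sum_natpermute)
  \<comment> \<open>The weights of \<open>k\<close> in \<open>h_eig\<close> add up to zero, so a
    common shift by \<open>q\<close> leaves no trace there.\<close>
  have z: "(\<Sum>i<n. real n - 1 - 2 * real i) = 0"
    using sum_pairs_diff[of "\<lambda>_. 1::real" n] by simp
  have "h_eig n k (map ((+) q) v) = (\<Sum>i<n. real q ^ 2 + (2 * real q + real d + k * (real n - 1)) * real (v ! i)
      + k * real q * (real n - 1 - 2 * real i)
      - (real (v ! i) * (real d - real (v ! i)) + 2 * k * (real i * real (v ! i))))"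
    unfolding h_eig_def using len
    by (intro sum.cong refl) (simp add: power2_eq_square algebra_simps)
  also have "\<dots> = real n * real q ^ 2 + (2 * real q + real d + k * (real n - 1)) * (\<Sum>i<n. real (v ! i))
      + k * real q * (\<Sum>i<n. real n - 1 - 2 * real i)
      - ((\<Sum>i<n. real (v ! i) * (real d - real (v ! i))) + 2 * k * (\<Sum>i<n. real i * real (v ! i)))"
    by (simp only: sum.distrib sum_subtractf sum_distrib_left[symmetric]) simp
  finally show ?thesis unfolding z d by (simp add: power2_eq_square algebra_simps)
qed

text \<open>For the single row both deficits in \<open>h_eig_shift\<close> vanish. Any other
  \<open>v\<close> has a positive entry after the first, which makes the second deficit
  positive.\<close>

lemma h_eig_less:
  assumes v: "v \<in> natpermute d n" and ne: "v \<noteq> d # replicate (n - 1) 0" and "n > 0" "k > 0"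
  shows "h_eig n k (map ((+) q) v) < h_eig n k (map ((+) q) (d # replicate (n - 1) 0))"
proof -
  define u where "u = d # replicate (n - 1) 0"
  have u: "u \<in> natpermute d n" using \<open>n > 0\<close> by (simp add: u_def natpermute_def)
  have u0: "u ! i = (if i = 0 then d else 0)" if "i < n" for i
    using that by (auto simp: u_def nth_Cons split: nat.split)
  have len: "length v = n" and sum: "sum_list v = d" using v by (auto simp: natpermute_def)
  have "(\<Sum>i<n. real (u ! i) * (real d - real (u ! i))) = 0" "(\<Sum>i<n. real i * real (u ! i)) = 0"
    using u0 by (auto intro!: sum.neutral)
  moreover have "(\<Sum>i<n. real (v ! i) * (real d - real (v ! i))) \<ge> 0"
  proof (intro sum_nonneg mult_nonneg_nonneg)
    fix i assume "i \<in> {..<n}"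
    then have "v ! i \<le> d" using elem_le_sum_list[of i v] len sum by simp
    then show "0 \<le> real d - real (v ! i)" by simp
  qed auto
  moreover have "(\<Sum>i<n. real i * real (v ! i)) > 0"
  proof -
    have "\<exists>i<n. i > 0 \<and> v ! i > 0"
    proof (rule ccontr)
      assume none: "\<not> (\<exists>i<n. i > 0 \<and> v ! i > 0)"
      have "d = (\<Sum>i<n. v ! i)" using sum len by (simp add: sum_list_sum_nth atLeast0LessThan)
      also have "\<dots> = (\<Sum>i<n. if i = 0 then v ! 0 else 0)" using none by (intro sum.cong) auto
      also have "\<dots> = v ! 0" using \<open>n > 0\<close> by (simp add: sum.delta)
      finally have "v = u" using u u0 none len by (intro nth_equalityI) (auto simp: natpermute_def)
      with ne show False by (simp add: u_def)
    qed
    then obtain i where "i < n" "i > 0" "v ! i > 0" by blast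
    then show ?thesis by (intro sum_pos2[of _ i]) auto
  qed
  then have "k * (\<Sum>i<n. real i * real (v ! i)) > 0" using \<open>k > 0\<close> by simp
  ultimately show ?thesis unfolding u_def[symmetric] h_eig_shift[OF v] h_eig_shift[OF u] by simp
qed

section \<open>The Jack polynomial of \<open>(p,q,\<dots>,q)\<close>\<close>

definition row_exponents :: "nat \<Rightarrow> nat \<Rightarrow> nat \<Rightarrow> nat list set" where
  "row_exponents n q d = map ((+) q) ` natpermute d n"

lemma sum_list_map_add: "sum_list (map ((+) q) v) = length v * q + sum_list v"
  for v :: "nat list"
  by (induction v) auto

lemma length_mult_le_sum_list:
  "(\<And>x. x \<in> set xs \<Longrightarrow> q \<le> x) \<Longrightarrow> length xs * q \<le> sum_list xs"
  for xs :: "nat list"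
  by (induction xs) (auto simp: add_mono)

lemma row_exponents_iff:
  "s \<in> row_exponents n q d \<longleftrightarrow> length s = n \<and> sum_list s = n * q + d \<and> (\<forall>x\<in>set s. q \<le> x)"
proof
  assume "s \<in> row_exponents n q d"
  then show "length s = n \<and> sum_list s = n * q + d \<and> (\<forall>x\<in>set s. q \<le> x)"
    by (auto simp: row_exponents_def natpermute_def sum_list_map_add)
next
  assume s: "length s = n \<and> sum_list s = n * q + d \<and> (\<forall>x\<in>set s. q \<le> x)"
  define v where "v = map (\<lambda>x. x - q) s"
  have sv: "s = map ((+) q) v" using s by (auto simp: v_def o_def intro!: map_idI[symmetric])
  moreover have "length v = n" using s by (simp add: v_def)
  then have "v \<in> natpermute d n"
    using s sum_list_map_add[of q v] unfolding sv[symmetric] by (simp add: natpermute_def)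
  ultimately show "s \<in> row_exponents n q d" by (auto simp: row_exponents_def)
qed

lemma finite_row_exponents: "finite (row_exponents n q d)"
  by (simp add: row_exponents_def natpermute_finite)

lemma sum_row_exponents:
  "(\<Sum>s\<in>row_exponents n q d. g s) = (\<Sum>v\<in>natpermute d n. g (map ((+) q) v))"
  unfolding row_exponents_def by (subst sum.reindex) (auto simp: inj_on_def inj_map_eq_map inj_def)

text \<open>Being dominated by \<open>(p,q,\<dots>,q)\<close> only says that the last part, hence every part, is at least \<open>q\<close>.\<close>

lemma dominated_by_row_iff:
  assumes "n > 0"
  shows "is_partition n mu \<and> dominates mu ((q + d) # replicate (n - 1) q) \<longleftrightarrow>
     mu \<in> row_exponents n q d \<and> sorted_wrt (\<ge>) mu"
proof -
  define lam where "lam = (q + d) # replicate (n - 1) q"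
  have sum_lam: "sum_list lam = n * q + d"
    using assms by (cases n) (auto simp: lam_def sum_list_replicate)
  have take_lam: "sum_list (take j lam) = j * q + d" if "0 < j" "j \<le> n" for j
    using that by (cases j) (auto simp: lam_def sum_list_replicate min_def)
  show ?thesis unfolding lam_def[symmetric]
  proof
    assume mu: "is_partition n mu \<and> dominates mu lam"
    then have len: "length mu = n" and srt: "sorted_wrt (\<ge>) mu" and sum: "sum_list mu = n * q + d"
      and dom: "\<And>j. sum_list (take j mu) \<le> sum_list (take j lam)"
      by (auto simp: is_partition_def dominates_def sum_lam)
    have "mu \<noteq> []" using len assms by auto
    then obtain xs x where xs: "mu = xs @ [x]" by (metis rev_exhaust)
    then have n: "n = Suc (length xs)" using len by simp
    \<comment> \<open>Dominance at the first \<open>n - 1\<close> parts leaves at least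
      \<open>q\<close> for the last one. For \<open>n = 1\<close> that partial sum is empty and
      \<open>take_lam\<close> does not cover it.\<close>
    have "q \<le> x"
    proof (cases "xs = []")
      case True
      then show ?thesis using sum xs n by simp
    next
      case False
      then have "sum_list xs \<le> length xs * q + d"
        using dom[of "length xs"] take_lam[of "length xs"] by (simp add: n xs)
      then show ?thesis using sum by (simp add: n xs)
    qed
    then show "mu \<in> row_exponents n q d \<and> sorted_wrt (\<ge>) mu"
      using len sum srt by (auto simp: row_exponents_iff xs sorted_wrt_append)
  next
    assume mu: "mu \<in> row_exponents n q d \<and> sorted_wrt (\<ge>) mu"
    have "sum_list (take j mu) \<le> sum_list (take j lam)" for j
    proof (cases "0 < j \<and> j \<le> n")
      case True
      \<comment> \<open>The parts after the first \<open>j\<close> use up at least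
        \<open>(n - j) * q\<close>, so at most \<open>j * q + d\<close> remains for the first
        \<open>j\<close>.\<close>
      have "length (drop j mu) * q \<le> sum_list (drop j mu)"
        using mu by (intro length_mult_le_sum_list) (auto simp: row_exponents_iff dest: in_set_dropD)
      moreover have "sum_list (take j mu) + sum_list (drop j mu) = n * q + d"
        using mu by (simp add: row_exponents_iff flip: sum_list_append)
      moreover have "n * q = j * q + (n - j) * q" using True by (metis add_mult_distrib le_add_diff_inverse)
      ultimately show ?thesis using True mu by (simp add: take_lam row_exponents_iff)
    next
      case False
      then consider "j = 0" | "j \<ge> n" by linarith
      then show ?thesis using mu sum_lam assms
        by cases (auto simp: row_exponents_iff lam_def)
    qed
    then show "is_partition n mu \<and> dominates mu lam"
      using mu by (auto simp: is_partition_def dominates_def sum_lam row_exponents_iff)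
  qed
qed

section \<open>Grouping monomials into permutation orbits\<close>

lemma rev_sort_eq: "sorted_wrt (\<ge>) s \<Longrightarrow> rev (sort s) = s"
  for s :: "'a::linorder list"
  using properties_for_sort[of "rev s" s] by (simp add: sorted_wrt_rev)

lemma rev_sort_eq_iff:
  fixes s t :: "'a::linorder list"
  assumes "sorted_wrt (\<ge>) s"
  shows "rev (sort t) = s \<longleftrightarrow> mset t = mset s"
proof
  assume "mset t = mset s"
  then have "sort t = sort s" by (intro properties_for_sort) auto
  then show "rev (sort t) = s" using assms by (simp add: rev_sort_eq)
qed auto

text \<open>\<open>rev (sort s)\<close> is the partition in the orbit of \<open>s\<close>. The set
  of row exponents is closed under permutation, so the fibres of this map are whole orbits, one for
  each \<open>monomial_sym\<close>.\<close>

lemma sum_monomial_sym_dominated: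
  assumes "n > 0"
  shows "(\<Sum>mu\<in>{mu. is_partition n mu \<and> dominates mu ((q + d) # replicate (n - 1) q)}. v mu * monomial_sym mu z)
    = (\<Sum>s\<in>row_exponents n q d. v (rev (sort s)) * (\<Prod>i<n. z i ^ (s ! i)))"
proof -
  define S where "S = row_exponents n q d"
  define P where "P = {mu \<in> S. sorted_wrt (\<ge>) mu}"
  have fin: "finite S" by (simp add: S_def finite_row_exponents)
  have perm: "t \<in> S \<longleftrightarrow> s \<in> S" if "mset t = mset s" for s t
    using mset_eq_length[OF that] mset_eq_setD[OF that] arg_cong[OF that, of sum_mset]
    unfolding sum_mset_sum_list by (simp add: S_def row_exponents_iff)
  have "v mu * monomial_sym mu z = (\<Sum>s\<in>{s\<in>S. rev (sort s) = mu}. v (rev (sort s)) * (\<Prod>i<n. z i ^ (s ! i)))"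
    if "mu \<in> P" for mu
  proof -
    have mu: "mu \<in> S" "sorted_wrt (\<ge>) mu" using that by (auto simp: P_def)
    have rs: "rev (sort s) = mu \<longleftrightarrow> mset s = mset mu" for s using mu(2) by (rule rev_sort_eq_iff)
    have "{s\<in>S. rev (sort s) = mu} = {s. mset s = mset mu}"
      unfolding rs using perm[of _ mu] mu(1) by blast
    moreover have "length mu = n" using mu(1) by (simp add: S_def row_exponents_iff)
    moreover have "rev (sort s) = mu" if "mset s = mset mu" for s using that rs by blast
    ultimately show ?thesis by (simp add: monomial_sym_def sum_distrib_left)
  qed
  then have "(\<Sum>mu\<in>P. v mu * monomial_sym mu z) =
      (\<Sum>mu\<in>P. \<Sum>s\<in>{s\<in>S. rev (sort s) = mu}. v (rev (sort s)) * (\<Prod>i<n. z i ^ (s ! i)))"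
    by (rule sum.cong[OF refl])
  also have "\<dots> = (\<Sum>s\<in>S. v (rev (sort s)) * (\<Prod>i<n. z i ^ (s ! i)))"
  proof (rule sum.group)
    show "(\<lambda>s. rev (sort s)) ` S \<subseteq> P"
    proof (rule image_subsetI)
      fix s assume "s \<in> S"
      moreover have "mset (rev (sort s)) = mset s" by simp
      ultimately have "rev (sort s) \<in> S" using perm by blast
      then show "rev (sort s) \<in> P" by (simp add: P_def sorted_wrt_rev)
    qed
  qed (use fin in \<open>auto simp: P_def\<close>)
  finally show ?thesis
    unfolding dominated_by_row_iff[OF assms] S_def P_def .
qed

text \<open>Running over the multiset of entries makes the coefficient invariant under permutation;
  the factor in front normalizes it to 1 at (q+d, q, ..., q).\<close>

definition row_coeff :: "complex \<Rightarrow> nat \<Rightarrow> nat \<Rightarrow> nat list \<Rightarrow> complex" where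
  "row_coeff a q d s = fact d / pochhammer a d *
     (\<Prod>x\<in>#mset s. pochhammer a (x - q) / fact (x - q))"

lemma row_coeff_rev_sort: "row_coeff a q d (rev (sort s)) = row_coeff a q d s"
  by (simp add: row_coeff_def)

lemma row_coeff_shift:
  assumes "length v = n"
  shows "row_coeff a q d (map ((+) q) v) * (\<Prod>i<n. z i ^ (map ((+) q) v ! i)) =
    fact d / pochhammer a d * (\<Prod>i<n. z i ^ q) * (\<Prod>i<n. fps_nth (negbin a (z i)) (v ! i))"
proof -
  have "row_coeff a q d (map ((+) q) v) = fact d / pochhammer a d * prod_list (map (\<lambda>x. pochhammer a x / fact x) v)"
    by (simp add: row_coeff_def o_def flip: prod_mset_prod_list mset_map)
  also have "prod_list (map (\<lambda>x. pochhammer a x / fact x) v) = (\<Prod>i<n. pochhammer a (v ! i) / fact (v ! i))"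
    using assms by (simp add: prod.list_conv_set_nth atLeast0LessThan)
  finally show ?thesis
    using assms by (simp add: negbin_nth prod.distrib prod_dividef power_add)
qed

lemma L_op_row:
  fixes z :: "nat \<Rightarrow> complex" and k :: real and n q d :: nat
  assumes z: "\<forall>i<n. \<forall>j<n. i \<noteq> j \<longrightarrow> z i \<noteq> z j" and "n > 0"
  defines "lam \<equiv> (q + d) # replicate (n - 1) q" and "a \<equiv> of_real k"
  shows "L_op n k (\<lambda>z. \<Sum>s\<in>row_exponents n q d. row_coeff a q d s * (\<Prod>i<n. z i ^ (s ! i))) z =
    of_real (h_eig n k lam) * (\<Sum>s\<in>row_exponents n q d. row_coeff a q d s * (\<Prod>i<n. z i ^ (s ! i)))"
proof -
  define m where "m v = (\<Prod>i<n. fps_nth (negbin a (z i)) (v ! i))" for v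
  define C where "C = fact d / pochhammer a d * (\<Prod>i<n. z i ^ q)"
  define Q :: complex where "Q = of_nat (2 * q * d + n * q ^ 2)"
  have len: "length v = n" if "v \<in> natpermute d n" for v using that by (simp add: natpermute_def)
  have f: "(\<Sum>s\<in>row_exponents n q d. row_coeff a q d s * (\<Prod>i<n. z i ^ (s ! i))) = C * (\<Sum>v\<in>natpermute d n. m v)"
    unfolding sum_row_exponents sum_distrib_left
    by (intro sum.cong refl) (simp only: row_coeff_shift len C_def m_def)
  have Lsym: "L_symbol n k z (nth (map ((+) q) v)) = L_symbol n k z (nth v) + Q" if "v \<in> natpermute d n" for v
  proof -
    have "L_symbol n k z (nth (map ((+) q) v)) = L_symbol n k z (\<lambda>i. q + v ! i)"
      using len[OF that] by (intro L_symbol_cong) simp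
    also have "\<dots> = L_symbol n k z (nth v) + Q"
      unfolding Q_def using sum_natpermute[OF that, where 'a=nat] by (intro L_symbol_shift) simp
    finally show ?thesis .
  qed
  have "L_op n k (\<lambda>z. \<Sum>s\<in>row_exponents n q d. row_coeff a q d s * (\<Prod>i<n. z i ^ (s ! i))) z
     = (\<Sum>v\<in>natpermute d n. L_symbol n k z (nth (map ((+) q) v)) * (C * m v))"
    unfolding L_op_sum_monomials sum_row_exponents
    by (intro sum.cong refl) (simp only: row_coeff_shift len C_def m_def)
  also have "\<dots> = (\<Sum>v\<in>natpermute d n. (L_symbol n k z (nth v) + Q) * (C * m v))"
    by (intro sum.cong refl) (simp only: Lsym)
  also have "\<dots> = C * (\<Sum>v\<in>natpermute d n. L_symbol n k z (nth v) * m v) + Q * (C * (\<Sum>v\<in>natpermute d n. m v))"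
    by (simp only: distrib_left distrib_right sum.distrib sum_distrib_left mult_ac)
  also have "\<dots> = (of_real (real d ^ 2 + k * (real n - 1) * real d) + Q) * (C * (\<Sum>v\<in>natpermute d n. m v))"
    unfolding m_def a_def L_symbol_negbin_coefficients[OF z] by (simp add: algebra_simps)
  \<comment> \<open>The partition \<open>lam\<close> comes from the composition (d, 0, ..., 0),
    whose deficits in \<open>h_eig_shift\<close> are zero.\<close>
  also have "of_real (real d ^ 2 + k * (real n - 1) * real d) + Q = of_real (h_eig n k lam)"
  proof -
    define u where "u = d # replicate (n - 1) 0"
    have u: "u \<in> natpermute d n" "lam = map ((+) q) u"
      using \<open>n > 0\<close> by (simp_all add: u_def lam_def natpermute_def)
    have "u ! i = (if i = 0 then d else 0)" if "i < n" for i
      using that by (auto simp: u_def nth_Cons split: nat.split)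
    then have "(\<Sum>i<n. real (u ! i) * (real d - real (u ! i))) = 0" "(\<Sum>i<n. real i * real (u ! i)) = 0"
      by (auto intro!: sum.neutral)
    then have "h_eig n k lam = real n * real q ^ 2 + 2 * real q * real d + real d ^ 2 + k * (real n - 1) * real d"
      unfolding u(2) h_eig_shift[OF u(1)] by simp
    then show ?thesis by (simp add: Q_def)
  qed
  finally show ?thesis unfolding f .
qed

lemma jack_row:
  assumes "n > 0" "k > 0"
  shows "jack n k ((q + d) # replicate (n - 1) q) =
    (\<lambda>z. \<Sum>s\<in>row_exponents n q d. row_coeff (of_real k) q d s * (\<Prod>i<n. z i ^ (s ! i)))"
proof -
  define lam where "lam = (q + d) # replicate (n - 1) q"
  define c0 where "c0 = row_coeff (of_real k) q d"
  have lam_sorted: "sorted_wrt (\<ge>) lam"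
    unfolding lam_def by (auto simp: sorted_wrt_iff_nth_less nth_Cons split: nat.split)
  have "pochhammer (complex_of_real k) d \<noteq> 0"
    using pochhammer_pos[OF assms(2), of d] by (simp add: pochhammer_of_real)
  then have c0_lam: "c0 lam = 1"
    by (simp add: c0_def row_coeff_def lam_def)
  have expand: "(\<Sum>mu | is_partition n mu \<and> dominates mu lam. v mu * monomial_sym mu z) =
       (\<Sum>s\<in>row_exponents n q d. v (rev (sort s)) * (\<Prod>i<n. z i ^ (s ! i)))" for v z
    unfolding lam_def by (rule sum_monomial_sym_dominated) fact
  have L_row: "L_op n k (\<lambda>z. \<Sum>s\<in>row_exponents n q d. c0 s * (\<Prod>i<n. z i ^ (s ! i))) z =
      of_real (h_eig n k lam) * (\<Sum>s\<in>row_exponents n q d. c0 s * (\<Prod>i<n. z i ^ (s ! i)))"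
    if "\<forall>i<n. \<forall>j<n. i \<noteq> j \<longrightarrow> z i \<noteq> z j" for z
    unfolding lam_def c0_def by (rule L_op_row) fact+
  show ?thesis
    unfolding jack_def lam_def[symmetric] c0_def[symmetric]
  proof (rule the_equality)
    show "\<exists>v. v lam = 1 \<and>
          (\<lambda>z. \<Sum>s\<in>row_exponents n q d. c0 s * (\<Prod>i<n. z i ^ (s ! i))) =
          (\<lambda>z. \<Sum>mu | is_partition n mu \<and> dominates mu lam. v mu * monomial_sym mu z) \<and>
          (\<forall>z. (\<forall>i<n. \<forall>j<n. i \<noteq> j \<longrightarrow> z i \<noteq> z j) \<longrightarrow>
            L_op n k (\<lambda>z. \<Sum>s\<in>row_exponents n q d. c0 s * (\<Prod>i<n. z i ^ (s ! i))) z =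
            of_real (h_eig n k lam) *
            (\<Sum>s\<in>row_exponents n q d. c0 s * (\<Prod>i<n. z i ^ (s ! i))))"
    proof (intro exI[of _ c0] conjI allI impI)
      show "(\<lambda>z. \<Sum>s\<in>row_exponents n q d. c0 s * (\<Prod>i<n. z i ^ (s ! i))) =
          (\<lambda>z. \<Sum>mu | is_partition n mu \<and> dominates mu lam. c0 mu * monomial_sym mu z)"
        unfolding expand by (simp add: c0_def row_coeff_rev_sort)
    qed (use c0_lam L_row in blast)+
  next
    fix f
    define S where "S = row_exponents n q d"
    assume "\<exists>v. v lam = 1 \<and>
          f = (\<lambda>z. \<Sum>mu | is_partition n mu \<and> dominates mu lam. v mu * monomial_sym mu z) \<and>
          (\<forall>z. (\<forall>i<n. \<forall>j<n. i \<noteq> j \<longrightarrow> z i \<noteq> z j) \<longrightarrow>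
            L_op n k f z = of_real (h_eig n k lam) * f z)"
    then obtain v where v1: "v lam = 1"
      and f: "f = (\<lambda>z. \<Sum>s\<in>S. v (rev (sort s)) * (\<Prod>i<n. z i ^ (s ! i)))"
      and L: "\<And>z. \<forall>i<n. \<forall>j<n. i \<noteq> j \<longrightarrow> z i \<noteq> z j \<Longrightarrow> L_op n k f z = of_real (h_eig n k lam) * f z"
      unfolding expand S_def by blast
    \<comment> \<open>Both candidates have coefficient 1 at \<open>lam\<close>, so the difference
      \<open>c\<close> vanishes there. Every other exponent list has a strictly smaller eigenvalue
      by \<open>h_eig_less\<close>, as \<open>L_op_eigenfunction_unique\<close> requires.\<close>
    define c where "c s = v (rev (sort s)) - c0 s" for s
    have c_lam: "c lam = 0"
      using v1 c0_lam by (simp add: c_def rev_sort_eq lam_sorted)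
    have "c s = 0" if "s \<in> S" for s
    proof (rule L_op_eigenfunction_unique[where S = S and n = n and k = k and E = "h_eig n k lam"])
      fix z :: "nat \<Rightarrow> complex"
      assume z: "\<forall>i<n. \<forall>j<n. i \<noteq> j \<longrightarrow> z i \<noteq> z j"
      have "(\<Sum>s\<in>S. L_symbol n k z (nth s) * (c s * (\<Prod>j<n. z j ^ (s ! j))))
        = L_op n k f z - L_op n k (\<lambda>z. \<Sum>s\<in>S. c0 s * (\<Prod>i<n. z i ^ (s ! i))) z"
        unfolding f L_op_sum_monomials sum_subtractf[symmetric] c_def
        by (intro sum.cong refl) (simp only: left_diff_distrib right_diff_distrib)
      also have "\<dots> = of_real (h_eig n k lam) * f z - of_real (h_eig n k lam) * (\<Sum>s\<in>S. c0 s * (\<Prod>i<n. z i ^ (s ! i)))"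
        unfolding L[OF z] S_def L_row[OF z] ..
      also have "\<dots> = of_real (h_eig n k lam) * (\<Sum>s\<in>S. c s * (\<Prod>j<n. z j ^ (s ! j)))"
        unfolding f c_def by (simp only: left_diff_distrib right_diff_distrib sum_subtractf)
      finally show "(\<Sum>s\<in>S. L_symbol n k z (nth s) * (c s * (\<Prod>j<n. z j ^ (s ! j))))
        = of_real (h_eig n k lam) * (\<Sum>s\<in>S. c s * (\<Prod>j<n. z j ^ (s ! j)))" .
    next
      fix s assume s: "s \<in> S" "c s \<noteq> 0"
      then obtain u where u: "u \<in> natpermute d n" "s = map ((+) q) u"
        by (auto simp: S_def row_exponents_def)
      have lam: "lam = map ((+) q) (d # replicate (n - 1) 0)" by (simp add: lam_def)
      have "u \<noteq> d # replicate (n - 1) 0"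
      proof
        assume "u = d # replicate (n - 1) 0"
        then have "s = lam" by (simp only: u(2) lam)
        with s c_lam show False by simp
      qed
      from h_eig_less[OF u(1) this assms] have "h_eig n k s < h_eig n k lam"
        by (simp only: u(2) lam)
      then show "h_eig n k s \<noteq> h_eig n k lam" by simp
    qed (use that in \<open>auto simp: S_def finite_row_exponents row_exponents_iff\<close>)
    then show "f = (\<lambda>z. \<Sum>s\<in>row_exponents n q d. c0 s * (\<Prod>i<n. z i ^ (s ! i)))"
      unfolding f by (intro ext sum.cong) (auto simp: S_def c_def)
  qed
qed

section \<open>Generating function of the Jack polynomial and the two hypergeometric forms\<close>

lemma jack_row_eq_fps_nth:
  assumes "n > 0" "k > 0"
  shows "jack n k ((q + d) # replicate (n - 1) q) z =
    fact d / pochhammer (of_real k) d * (\<Prod>i<n. z i ^ q) * fps_nth (\<Prod>i<n. negbin (of_real k) (z i)) d"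
  unfolding jack_row[OF assms] sum_row_exponents fps_prod_nth_lessThan[OF assms(1)] sum_distrib_left
  by (intro sum.cong refl) (simp add: row_coeff_shift natpermute_def del: nth_map)

lemma divide_mult_cong:
  fixes b c e g l u :: "'a::field"
  assumes "c * g = e * l"
  shows "c / b * u * g = e / b * u * l"
  using assms by (metis mult.commute mult.left_commute times_divide_eq_left)

theorem theorem3p1:
  fixes n p q :: nat and k :: real and z :: "nat \<Rightarrow> complex"
  assumes "n \<ge> 2" and "k > 0" and "p \<ge> q" and "z (n - 1) \<noteq> 0"
  shows "jack n k (p # replicate (n - 1) q) z =
           pochhammer (of_real (real n * k)) (p - q) / pochhammer (of_real k) (p - q)
           * (\<Prod>i<n - 1. z i ^ q) * z (n - 1) ^ p
           * lauricella_FD (of_int (int q - int p)) (\<lambda>_. of_real k) (of_real (real n * k)) (n - 1)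
               (\<lambda>i. 1 - z i / z (n - 1))
       \<and> jack n k (p # replicate (n - 1) q) z =
           (\<Prod>i<n - 1. z i ^ q) * z (n - 1) ^ p
           * lauricella_FD (of_int (int q - int p)) (\<lambda>_. of_real k)
               (of_int (int q - int p) - of_real k + 1) (n - 1)
               (\<lambda>i. z i / z (n - 1))"
proof -
  obtain m where n: "n = Suc m" and m: "m > 0" using assms(1) by (cases n) auto
  obtain d where p: "p = q + d" using assms(3) le_Suc_ex by blast
  define a :: complex where "a = of_real k"
  \<comment> \<open>Dividing by the last coordinate makes \<open>x m = 1\<close>, so the last factor
    of the product becomes the \<open>negbin a 1\<close> of both Lauricella lemmas. By homogeneity
    this costs the factor \<open>z m ^ d\<close>, which turns \<open>z m ^ q\<close> into
    \<open>z m ^ p\<close>.\<close>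
  define x where "x i = z i / z m" for i
  have zm: "z m \<noteq> 0" using assms(4) by (simp add: n)
  have x: "z i = z m * x i" and xm: "x m = 1" for i using zm by (simp_all add: x_def)
  have a: "of_nat (Suc m) * a \<noteq> - of_nat j" "a \<noteq> - of_nat j" for j
  proof -
    have "real (Suc m) * k > 0" using assms(2) by simp
    then have "real (Suc m) * k \<noteq> - real j" "k \<noteq> - real j" using assms(2) by linarith+
    then have "complex_of_real (real (Suc m) * k) \<noteq> of_real (- real j)" "complex_of_real k \<noteq> of_real (- real j)"
      by (simp_all only: of_real_eq_iff not_False_eq_True)
    then show "of_nat (Suc m) * a \<noteq> - of_nat j" "a \<noteq> - of_nat j" by (simp_all add: a_def)
  qed
  have pnz: "pochhammer a d \<noteq> 0" using a(2) by (auto simp: pochhammer_eq_0_iff)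
  define G where "G = fps_nth (negbin a 1 * (\<Prod>i<m. negbin a (x i))) d"
  have "fps_nth (\<Prod>i<n. negbin a (z i)) d = fps_nth (\<Prod>i<n. negbin a (z m * x i)) d"
    by (simp flip: x)
  also have "\<dots> = z m ^ d * G"
    unfolding negbin_prod_scale by (simp add: n xm G_def mult.commute)
  finally have jack: "jack n k (p # replicate (n - 1) q) z =
      fact d / pochhammer a d * (\<Prod>i<m. z i ^ q) * z m ^ p * G"
    using jack_row_eq_fps_nth[of n k q d z] assms(2)
    by (simp add: p a_def n power_add mult_ac)
  have d: "of_int (int q - int p) = (- of_nat d :: complex)" "p - q = d" "n - 1 = m"
    "complex_of_real (real n * k) = of_nat (Suc m) * a" "complex_of_real k = a"
    by (simp_all add: p n a_def)
  \<comment> \<open>Both Lauricella functions evaluate the same coefficient \<open>G\<close>. In the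
    second formula the prefactor \<open>pochhammer a d\<close> cancels against the normalization of
    the Jack polynomial.\<close>
  have "fact d * G = pochhammer (of_nat (Suc m) * a) d *
      lauricella_FD (- of_nat d) (\<lambda>_. a) (of_nat (Suc m) * a) m (\<lambda>i. 1 - x i)"
    unfolding G_def lauricella_FD_one_minus[OF m a(1), symmetric] by simp
  moreover have "fact d * G = pochhammer a d * lauricella_FD (- of_nat d) (\<lambda>_. a) (- of_nat d - a + 1) m x"
    unfolding G_def lauricella_FD_reverse[OF m a(2), symmetric] by simp
  ultimately show ?thesis
    unfolding jack unfolding d x_def[symmetric] using pnz by (auto simp: field_simps intro: divide_mult_cong)
qed

end
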